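(* Let $\mathcal{F}=\{f_i\}_{i\in\mathbb{N}}$ be a frame for $\mathcal{H}$ with optimal lower frame bound $A_{\mathcal{F}}>0$ and synthesis operator $F$. If $\dim N(F)=\infty$, then: 1. $\alpha(\mathcal{F})=1-\min\{A_{\mathcal{F}}^{1/2},1\}$. 2. The optimal lower bound $\alpha(\mathcal{F})$ is attained (i.e. $\mathfrak{X}(\mathcal{F})\neq\emptyset$). 3. If $X\in\mathfrak{X}(\mathcal{F})$, then $FX^*$ is an invertible operator in $B(\mathcal{H})$. 4. Moreover, we can choose $X\in\mathfrak{X}(\mathcal{F})$ such that $FX^*=\min\{A_{\mathcal{F}}^{1/2},1\}\,I$.
   Context: $\mathcal{H}$ is a separable infinite dimensional complex Hilbert space and $\ell_2=\ell_2(\mathbb{N})$. A sequence $\mathcal{F}=\{f_i\}_{i\in\mathbb{N}}$ in $\mathcal{H}$ is a frame for $\mathcal{H}$ if there exist $A,B>0$ with $A\|f\|^2\le\sum_{i\in\mathbb{N}}|\langle f,f_i\rangle|^2\le B\|f\|^2$ for all $f\in\mathcal{H}$; the largest such $A$ is the optimal lower frame bound $A_{\mathcal{F}}$. The synthesis operator $F\in B(\ell_2,\mathcal{H})$ is $F((a_i)_{i\in\mathbb{N}})=\sum_i a_if_i$, and $N(F)$ denotes its nullspace. Define $$\alpha(\mathcal{F})=\inf\{\|FX^*-I\|:\ X\in B(\ell_2,\mathcal{H}),\ XX^*=I_{\mathcal{H}}\},$$ $$\mathfrak{X}(\mathcal{F})=\{X\in B(\ell_2,\mathcal{H}):\ XX^*=I_{\mathcal{H}},\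 \|FX^*-I\|=\alpha(\mathcal{F})\},$$ where $\|\cdot\|$ is the operator norm. *)

theory Defs
  imports "HOL-Analysis.Analysis"
begin

section \<open>Complex Hilbert spaces\<close>

class complex_vector = real_vector +
  fixes scaleC :: "complex \<Rightarrow> 'a \<Rightarrow> 'a"  (infixr \<open>*\<^sub>C\<close> 75)
  assumes scaleC_add_right: "c *\<^sub>C (x + y) = c *\<^sub>C x + c *\<^sub>C y"
    and scaleC_add_left: "(c + d) *\<^sub>C x = c *\<^sub>C x + d *\<^sub>C x"
    and scaleC_scaleC: "c *\<^sub>C d *\<^sub>C x = (c * d) *\<^sub>C x"
    and scaleC_of_real: "complex_of_real r *\<^sub>C x = r *\<^sub>R x"

global_interpretation complex_vector: vector_space "scaleC :: complex \<Rightarrow> 'a \<Rightarrow> 'a::complex_vector"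
proof
  show "1 *\<^sub>C x = x" for x :: 'a
    using scaleC_of_real[of 1 x] by simp
qed (simp_all add: scaleC_add_right scaleC_add_left scaleC_scaleC)

text \<open>The complex inner product is linear in its first argument. Its real part is the real inner
  product, so that the norm is the usual one, and positive definiteness is inherited from
  \<^class>\<open>real_inner\<close>.\<close>

class complex_inner = complex_vector + real_inner +
  fixes cinner :: "'a \<Rightarrow> 'a \<Rightarrow> complex"
  assumes cinner_commute: "cinner x y = cnj (cinner y x)"
    and cinner_add_left: "cinner (x + y) z = cinner x z + cinner y z"
    and cinner_scaleC_left: "cinner (c *\<^sub>C x) y = c * cinner x y"
    and Re_cinner: "Re (cinner x y) = inner x y"

lemma cinner_self: "cinner x x = complex_of_real ((norm x)\<^sup>2)"
proof -
  have "Im (cinner x x) = Im (cnj (cinner x x))"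
    by (rule arg_cong[OF cinner_commute])
  then have "Im (cinner x x) = 0"
    unfolding cnj.sel by linarith
  then show ?thesis
    by (simp add: complex_eq_iff Re_cinner power2_norm_eq_inner)
qed

class chilbert_space = complex_inner + complete_space

definition infinite_cdim :: "'a::complex_vector set \<Rightarrow> bool" where
  "infinite_cdim S \<longleftrightarrow> \<not> (\<exists>B. finite B \<and> B \<subseteq> S \<and> complex_vector.span B = S)"

section \<open>The Hilbert space of square-summable sequences\<close>

typedef ell2 = "{a :: nat \<Rightarrow> complex. summable (\<lambda>i. (cmod (a i))\<^sup>2)}"
  morphisms ell2_coord Abs_ell2
proof
  show "(\<lambda>i. 0) \<in> {a :: nat \<Rightarrow> complex. summable (\<lambda>i. (cmod (a i))\<^sup>2)}" by simp
qed

setup_lifting type_definition_ell2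

lemma cmod_mult_le_squares: "cmod (x * y) \<le> (cmod x)\<^sup>2 + (cmod y)\<^sup>2"
proof -
  have "0 \<le> (cmod x - cmod y)\<^sup>2" "0 \<le> (cmod x)\<^sup>2" "0 \<le> (cmod y)\<^sup>2" by simp_all
  then show ?thesis
    unfolding norm_mult power2_diff by linarith
qed

lemma summable_square_add:
  assumes "summable (\<lambda>i. (cmod (a i))\<^sup>2)" "summable (\<lambda>i. (cmod (b i))\<^sup>2)"
  shows "summable (\<lambda>i. (cmod (a i + b i))\<^sup>2)"
proof (rule summable_comparison_test'[where N = 0])
  show "summable (\<lambda>i. 2 * (cmod (a i))\<^sup>2 + 2 * (cmod (b i))\<^sup>2)"
    using assms by (intro summable_add summable_mult)
  fix i
  have "(cmod (a i + b i))\<^sup>2 \<le> (cmod (a i) + cmod (b i))\<^sup>2"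
    by (intro power_mono norm_triangle_ineq) simp
  also have "\<dots> \<le> 2 * (cmod (a i))\<^sup>2 + 2 * (cmod (b i))\<^sup>2"
    using zero_le_power2[of "cmod (a i) - cmod (b i)"] by (simp add: power2_eq_square algebra_simps)
  finally show "norm ((cmod (a i + b i))\<^sup>2) \<le> 2 * (cmod (a i))\<^sup>2 + 2 * (cmod (b i))\<^sup>2" by simp
qed

lemma summable_square_mult:
  "summable (\<lambda>i. (cmod (a i))\<^sup>2) \<Longrightarrow> summable (\<lambda>i. (cmod (c * a i))\<^sup>2)"
  by (simp add: norm_mult power_mult_distrib summable_mult)

instantiation ell2 :: complex_vector
begin

lift_definition zero_ell2 :: ell2 is "\<lambda>i. 0" by simp
lift_definition plus_ell2 :: "ell2 \<Rightarrow> ell2 \<Rightarrow> ell2" is "\<lambda>a b i. a i + b i"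
  by (rule summable_square_add)
lift_definition uminus_ell2 :: "ell2 \<Rightarrow> ell2" is "\<lambda>a i. - a i" by simp
lift_definition minus_ell2 :: "ell2 \<Rightarrow> ell2 \<Rightarrow> ell2" is "\<lambda>a b i. a i - b i"
proof -
  fix a b :: "nat \<Rightarrow> complex"
  assume "summable (\<lambda>i. (cmod (a i))\<^sup>2)" "summable (\<lambda>i. (cmod (b i))\<^sup>2)"
  then show "summable (\<lambda>i. (cmod (a i - b i))\<^sup>2)"
    using summable_square_add[of a "\<lambda>i. - b i"] by simp
qed
lift_definition scaleC_ell2 :: "complex \<Rightarrow> ell2 \<Rightarrow> ell2" is "\<lambda>c a i. c * a i"
  by (rule summable_square_mult)
lift_definition scaleR_ell2 :: "real \<Rightarrow> ell2 \<Rightarrow> ell2" is "\<lambda>r a i. complex_of_real r * a i"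
  by (rule summable_square_mult)

instance
  by standard (transfer; simp add: algebra_simps)+

end

lemma summable_cinner_ell2: "summable (\<lambda>i. ell2_coord a i * cnj (ell2_coord b i))"
proof (rule summable_comparison_test'[where N = 0])
  show "summable (\<lambda>i. (cmod (ell2_coord a i))\<^sup>2 + (cmod (ell2_coord b i))\<^sup>2)"
    using ell2_coord[of a] ell2_coord[of b] by (simp add: summable_add)
  show "norm (ell2_coord a i * cnj (ell2_coord b i))
      \<le> (cmod (ell2_coord a i))\<^sup>2 + (cmod (ell2_coord b i))\<^sup>2" for i
    using cmod_mult_le_squares[of "ell2_coord a i" "cnj (ell2_coord b i)"] by simp
qed

instantiation ell2 :: complex_inner
begin

definition cinner_ell2 :: "ell2 \<Rightarrow> ell2 \<Rightarrow> complex" where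
  "cinner_ell2 a b = (\<Sum>i. ell2_coord a i * cnj (ell2_coord b i))"
definition inner_ell2 :: "ell2 \<Rightarrow> ell2 \<Rightarrow> real" where
  "inner_ell2 a b = Re (cinner a b)"
definition norm_ell2 :: "ell2 \<Rightarrow> real" where
  "norm_ell2 a = sqrt (inner a a)"
definition sgn_ell2 :: "ell2 \<Rightarrow> ell2" where
  "sgn_ell2 a = a /\<^sub>R norm a"
definition dist_ell2 :: "ell2 \<Rightarrow> ell2 \<Rightarrow> real" where
  "dist_ell2 a b = norm (a - b)"
definition uniformity_ell2 :: "(ell2 \<times> ell2) filter" where
  "uniformity_ell2 = (INF e\<in>{0 <..}. principal {(x, y). dist x y < e})"
definition open_ell2 :: "ell2 set \<Rightarrow> bool" where
  "open_ell2 U \<longleftrightarrow> (\<forall>x\<in>U. eventually (\<lambda>(x', y). x' = x \<longrightarrow> y \<in> U) uniformity)"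

instance
proof
  fix x y z :: ell2 and r :: real and c :: complex and U :: "ell2 set"
  show "dist x y = norm (x - y)" by (rule dist_ell2_def)
  show "sgn x = x /\<^sub>R norm x" by (rule sgn_ell2_def)
  show "uniformity = (INF e\<in>{0 <..}. principal {(x :: ell2, y). dist x y < e})"
    by (rule uniformity_ell2_def)
  show "open U \<longleftrightarrow> (\<forall>x\<in>U. eventually (\<lambda>(x', y). x' = x \<longrightarrow> y \<in> U) uniformity)"
    by (rule open_ell2_def)
  show "norm x = sqrt (inner x x)" by (rule norm_ell2_def)
  show comm: "cinner x y = cnj (cinner y x)" for x y :: ell2
    using bounded_linear.suminf[OF bounded_linear_cnj summable_cinner_ell2[of y x]]
    by (simp add: cinner_ell2_def mult.commute)
  show add: "cinner (x + y) z = cinner x z + cinner y z" for x y z :: ell2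
    by (simp add: cinner_ell2_def plus_ell2.rep_eq distrib_right suminf_add summable_cinner_ell2)
  show scale: "cinner (c *\<^sub>C x) y = c * cinner x y" for c and x y :: ell2
    by (simp add: cinner_ell2_def scaleC_ell2.rep_eq mult.assoc suminf_mult summable_cinner_ell2)
  show "Re (cinner x y) = inner x y" by (simp add: inner_ell2_def)
  show "inner x y = inner y x" unfolding inner_ell2_def by (subst comm) simp
  show "inner (x + y) z = inner x z + inner y z" by (simp add: inner_ell2_def add)
  show "inner (r *\<^sub>R x) y = r * inner x y"
    by (simp add: inner_ell2_def scale flip: scaleC_of_real)
  have summ: "summable (\<lambda>i. (cmod (ell2_coord x i))\<^sup>2)"
    using ell2_coord[of x] by simp
  have xx: "inner x x = (\<Sum>i. (cmod (ell2_coord x i))\<^sup>2)"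
    unfolding inner_ell2_def cinner_ell2_def
    by (subst bounded_linear.suminf[OF bounded_linear_Re summable_cinner_ell2])
       (simp add: complex_mult_cnj cmod_power2)
  show "0 \<le> inner x x" unfolding xx by (intro suminf_nonneg summ) simp
  have "inner x x = 0 \<longleftrightarrow> (\<forall>i. ell2_coord x i = 0)"
    unfolding xx using suminf_eq_zero_iff[OF summ] by simp
  then show "inner x x = 0 \<longleftrightarrow> x = 0"
    by (simp add: ell2_coord_inject[symmetric] zero_ell2.rep_eq fun_eq_iff)
qed

end

lemma summable_ell2: "summable (\<lambda>i. (cmod (ell2_coord a i))\<^sup>2)"
  using ell2_coord[of a] by simp

lemma norm_ell2: "(norm (a :: ell2))\<^sup>2 = (\<Sum>i. (cmod (ell2_coord a i))\<^sup>2)"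
proof -
  have "(norm a)\<^sup>2 = Re (cinner a a)" by (simp add: cinner_self)
  also have "\<dots> = (\<Sum>i. (cmod (ell2_coord a i))\<^sup>2)"
    unfolding cinner_ell2_def
    by (subst bounded_linear.suminf[OF bounded_linear_Re summable_cinner_ell2])
       (simp add: complex_mult_cnj cmod_power2)
  finally show ?thesis .
qed

lemma sum_le_norm_ell2: "(\<Sum>i<k. (cmod (ell2_coord a i))\<^sup>2) \<le> (norm a)\<^sup>2"
  unfolding norm_ell2 by (intro sum_le_suminf summable_ell2) simp_all

lemma cmod_coord_le_norm: "cmod (ell2_coord a i) \<le> norm a"
proof (rule power2_le_imp_le)
  show "(cmod (ell2_coord a i))\<^sup>2 \<le> (norm a)\<^sup>2"
    unfolding norm_ell2 using sum_le_suminf[OF summable_ell2, of "{i}" a] by simp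
qed simp

instance ell2 :: chilbert_space
proof
  fix X :: "nat \<Rightarrow> ell2"
  assume X: "Cauchy X"
  have "Cauchy (\<lambda>n. ell2_coord (X n) i)" for i
  proof (rule CauchyI)
    fix e :: real assume "0 < e"
    then obtain M where M: "\<forall>m\<ge>M. \<forall>n\<ge>M. norm (X m - X n) < e"
      using CauchyD[OF X] by blast
    have "norm (ell2_coord (X m) i - ell2_coord (X n) i) < e" if "m \<ge> M" "n \<ge> M" for m n
    proof -
      have "norm (ell2_coord (X m - X n) i) \<le> norm (X m - X n)" by (rule cmod_coord_le_norm)
      also have "\<dots> < e" using M that by blast
      finally show ?thesis by (simp add: minus_ell2.rep_eq)
    qed
    then show "\<exists>M. \<forall>m\<ge>M. \<forall>n\<ge>M. norm (ell2_coord (X m) i - ell2_coord (X n) i) < e" by blast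
  qed
  then have "\<forall>i. \<exists>l. (\<lambda>n. ell2_coord (X n) i) \<longlonglongrightarrow> l"
    by (simp add: Cauchy_convergent_iff convergent_def)
  then obtain l where l: "\<And>i. (\<lambda>n. ell2_coord (X n) i) \<longlonglongrightarrow> l i" by metis
  have bound: "(\<Sum>i<k. (cmod (ell2_coord (X m) i - l i))\<^sup>2) \<le> e\<^sup>2"
    if "\<forall>m\<ge>M. \<forall>n\<ge>M. norm (X m - X n) < e" "m \<ge> M" for m M k and e :: real
  proof (rule tendsto_upperbound)
    show "(\<lambda>n. \<Sum>i<k. (cmod (ell2_coord (X m) i - ell2_coord (X n) i))\<^sup>2)
        \<longlonglongrightarrow> (\<Sum>i<k. (cmod (ell2_coord (X m) i - l i))\<^sup>2)"
      by (intro tendsto_intros l)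
    have "(\<Sum>i<k. (cmod (ell2_coord (X m) i - ell2_coord (X n) i))\<^sup>2) \<le> e\<^sup>2" if "n \<ge> M" for n
    proof -
      have "(\<Sum>i<k. (cmod (ell2_coord (X m) i - ell2_coord (X n) i))\<^sup>2) \<le> (norm (X m - X n))\<^sup>2"
        using sum_le_norm_ell2[of "X m - X n" k] by (simp add: minus_ell2.rep_eq)
      moreover have "norm (X m - X n) \<le> e"
        using \<open>\<forall>m\<ge>M. \<forall>n\<ge>M. norm (X m - X n) < e\<close> \<open>m \<ge> M\<close> that less_imp_le by blast
      then have "(norm (X m - X n))\<^sup>2 \<le> e\<^sup>2"
        by (rule power_mono) simp
      ultimately show ?thesis by (rule order_trans)
    qed
    then show "\<forall>\<^sub>F n in sequentially.
        (\<Sum>i<k. (cmod (ell2_coord (X m) i - ell2_coord (X n) i))\<^sup>2) \<le> e\<^sup>2"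
      using eventually_sequentially by blast
  qed simp
  have summ: "summable (\<lambda>i. (cmod (ell2_coord (X m) i - l i))\<^sup>2)"
    if "\<forall>m\<ge>M. \<forall>n\<ge>M. norm (X m - X n) < e" "m \<ge> M" for m M and e :: real
    using bound[OF that] by (intro summableI_nonneg_bounded) auto
  have "summable (\<lambda>i. (cmod (l i))\<^sup>2)"
  proof -
    obtain M where M: "\<forall>m\<ge>M. \<forall>n\<ge>M. norm (X m - X n) < 1"
      using CauchyD[OF X, of 1] by auto
    have "summable (\<lambda>i. (cmod (l i - ell2_coord (X M) i))\<^sup>2)"
      using summ[OF M, of M] by (simp add: norm_minus_commute)
    from summable_square_add[OF this summable_ell2[of "X M"]] show ?thesis by simp
  qed
  then have coord: "ell2_coord (Abs_ell2 l) = l" by (simp add: Abs_ell2_inverse)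
  have "X \<longlonglongrightarrow> Abs_ell2 l"
  proof (rule LIMSEQ_I)
    fix r :: real assume "0 < r"
    then obtain M where M: "\<forall>m\<ge>M. \<forall>n\<ge>M. norm (X m - X n) < r / 2"
      using CauchyD[OF X, of "r / 2"] by auto
    have "norm (X m - Abs_ell2 l) < r" if "m \<ge> M" for m
    proof -
      have "(norm (X m - Abs_ell2 l))\<^sup>2 \<le> (r / 2)\<^sup>2"
        unfolding norm_ell2 minus_ell2.rep_eq coord
        by (intro suminf_le_const summ[OF M that] bound[OF M that])
      then have "norm (X m - Abs_ell2 l) \<le> r / 2"
        by (rule power2_le_imp_le) (use \<open>0 < r\<close> in linarith)
      then show ?thesis using \<open>0 < r\<close> by simp
    qed
    then show "\<exists>no. \<forall>n\<ge>no. norm (X n - Abs_ell2 l) < r" by blast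
  qed
  then show "convergent X" by (auto simp: convergent_def)
qed

section \<open>Bounded operators\<close>

definition bounded_clinear :: "('a::complex_inner \<Rightarrow> 'b::complex_inner) \<Rightarrow> bool" where
  "bounded_clinear T \<longleftrightarrow> bounded_linear T \<and> (\<forall>c x. T (c *\<^sub>C x) = c *\<^sub>C T x)"

text \<open>As for the library's real \<^const>\<open>adjoint\<close>, the value is only meaningful where an adjoint
  exists; for bounded operators on a Hilbert space it exists and is unique by the Riesz
  representation theorem.\<close>

definition cadjoint :: "('a::complex_inner \<Rightarrow> 'b::complex_inner) \<Rightarrow> 'b \<Rightarrow> 'a" where
  "cadjoint T = (SOME S. \<forall>x y. cinner (T x) y = cinner x (S y))"

definition invertible_operator :: "('a::complex_inner \<Rightarrow> 'a) \<Rightarrow> bool" where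
  "invertible_operator T \<longleftrightarrow>
    bounded_clinear T \<and> (\<exists>S. bounded_clinear S \<and> T \<circ> S = id \<and> S \<circ> T = id)"

section \<open>Frames\<close>

text \<open>Summability is required explicitly because \<^const>\<open>suminf\<close> of a divergent series is an
  unspecified real.\<close>

definition frame_bounds :: "(nat \<Rightarrow> 'h::complex_inner) \<Rightarrow> real \<Rightarrow> real \<Rightarrow> bool" where
  "frame_bounds f A B \<longleftrightarrow> A > 0 \<and> B > 0 \<and>
    (\<forall>h. summable (\<lambda>i. (cmod (cinner h (f i)))\<^sup>2) \<and>
         A * (norm h)\<^sup>2 \<le> (\<Sum>i. (cmod (cinner h (f i)))\<^sup>2) \<and>
         (\<Sum>i. (cmod (cinner h (f i)))\<^sup>2) \<le> B * (norm h)\<^sup>2)"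

definition is_frame :: "(nat \<Rightarrow> 'h::complex_inner) \<Rightarrow> bool" where
  "is_frame f \<longleftrightarrow> (\<exists>A B. frame_bounds f A B)"

definition optimal_lower_frame_bound :: "(nat \<Rightarrow> 'h::complex_inner) \<Rightarrow> real" where
  "optimal_lower_frame_bound f = (GREATEST A. \<exists>B. frame_bounds f A B)"

definition synthesis :: "(nat \<Rightarrow> 'h::complex_inner) \<Rightarrow> ell2 \<Rightarrow> 'h" where
  "synthesis f a = (\<Sum>i. ell2_coord a i *\<^sub>C f i)"

definition nullspace :: "('a::complex_inner \<Rightarrow> 'b::complex_inner) \<Rightarrow> 'a set" where
  "nullspace T = {x. T x = 0}"

definition coisometry :: "(ell2 \<Rightarrow> 'h::complex_inner) \<Rightarrow> bool" where
  "coisometry X \<longleftrightarrow> bounded_clinear X \<and> X \<circ> cadjoint X = id"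

definition frame_alpha :: "(nat \<Rightarrow> 'h::complex_inner) \<Rightarrow> real" where
  "frame_alpha f = Inf {onorm (\<lambda>h. synthesis f (cadjoint X h) - h) | X. coisometry X}"

definition frame_minimizers :: "(nat \<Rightarrow> 'h::complex_inner) \<Rightarrow> (ell2 \<Rightarrow> 'h) set" where
  "frame_minimizers f =
    {X. coisometry X \<and> onorm (\<lambda>h. synthesis f (cadjoint X h) - h) = frame_alpha f}"

end

theory Submission
  imports Defs
begin

text \<open>Let \<open>A\<close> be the optimal lower bound, \<open>c = min (sqrt A) 1\<close> and \<open>S = F F\<^sup>*\<close>. For every coisometry \<open>X\<close>,
  \<open>Re \<langle>F X\<^sup>* h, h\<rangle> = Re \<langle>X\<^sup>* h, F\<^sup>* h\<rangle> \<le> \<parallel>h\<parallel> \<parallel>F\<^sup>* h\<parallel>\<close>, and optimality of \<open>A\<close> makes the right-hand side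
  at most about \<open>sqrt A \<parallel>h\<parallel>\<^sup>2\<close> for a suitable \<open>h\<close>; hence the defect \<open>\<parallel>F X\<^sup>* - I\<parallel>\<close> is at least
  \<open>1 - c\<close>. For equality take \<open>X\<^sup>* = c F\<^sup>* S\<^sup>-\<^sup>1 + W\<close> with \<open>W\<close> mapping into the nullspace of \<open>F\<close>: then
  \<open>F X\<^sup>* = c I\<close>, and \<open>X\<^sup>*\<close> is isometric iff \<open>W\<^sup>* W\<close> is the positive contraction \<open>I - c\<^sup>2 S\<^sup>-\<^sup>1\<close>. Such a \<open>W\<close>
  exists because the space is separable and the nullspace contains an infinite orthonormal
  sequence. Minimizers give
  invertible operators since \<open>1 - c < 1\<close>.\<close>

section \<open>The complex inner product\<close>

instance chilbert_space \<subseteq> banach ..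

lemma cinner_add_right: "cinner x (y + z) = cinner x y + cinner x z"
  by (metis cinner_add_left cinner_commute complex_cnj_add)

lemma cinner_scaleC_right: "cinner x (c *\<^sub>C y) = cnj c * cinner x y"
  by (metis cinner_scaleC_left cinner_commute complex_cnj_mult)

lemma cinner_scaleR_left: "cinner (r *\<^sub>R x) y = complex_of_real r * cinner x y"
  by (metis cinner_scaleC_left scaleC_of_real)

lemma cinner_scaleR_right: "cinner x (r *\<^sub>R y) = complex_of_real r * cinner x y"
  by (metis cinner_scaleC_right scaleC_of_real complex_cnj_complex_of_real)

lemma cinner_diff_left: "cinner (x - y) z = cinner x z - cinner y z"
  by (metis cinner_add_left add_diff_cancel_right' diff_add_cancel)

lemma cinner_diff_right: "cinner x (y - z) = cinner x y - cinner x z"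
  by (metis cinner_add_right add_diff_cancel_right' diff_add_cancel)

lemma cinner_zero_left [simp]: "cinner 0 y = 0"
  using cinner_diff_left[of y y y] by simp

lemma cinner_zero_right [simp]: "cinner y 0 = 0"
  using cinner_diff_right[of y y y] by simp

lemma norm_scaleC: "norm (c *\<^sub>C x) = cmod c * norm (x :: 'a::complex_inner)"
proof -
  have "complex_of_real ((norm (c *\<^sub>C x))\<^sup>2) = (c * cnj c) * cinner x x"
    by (simp add: cinner_self[symmetric] cinner_scaleC_left cinner_scaleC_right mult_ac
        del: of_real_power)
  also have "\<dots> = complex_of_real ((cmod c * norm x)\<^sup>2)"
    by (simp add: cinner_self power_mult_distrib flip: complex_norm_square)
  finally have "(norm (c *\<^sub>C x))\<^sup>2 = (cmod c * norm x)\<^sup>2"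
    using of_real_eq_iff by blast
  then show ?thesis by simp
qed

text \<open>Multiplying \<open>x\<close> by the conjugate of <x, y> turns the inner product into the
  nonnegative real |<x, y>|^2. The real Cauchy-Schwarz inequality then applies, and one factor |<x,
  y>| cancels.\<close>

lemma cmod_cinner_le: "cmod (cinner x y) \<le> norm x * norm y"
proof -
  let ?z = "cinner x y"
  have "(cmod ?z)\<^sup>2 = Re (cinner (cnj ?z *\<^sub>C x) y)"
    by (simp add: cinner_scaleC_left cmod_power2) (simp add: power2_eq_square)
  also have "\<dots> \<le> norm (cnj ?z *\<^sub>C x) * norm y"
    unfolding Re_cinner by (rule norm_cauchy_schwarz)
  finally have "cmod ?z * cmod ?z \<le> cmod ?z * (norm x * norm y)"
    by (simp add: norm_scaleC power2_eq_square mult_ac)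
  then show ?thesis
    by (cases "?z = 0") (auto simp: mult_le_cancel_left)
qed

lemma bounded_linear_cinner_left: "bounded_linear (\<lambda>x. cinner x y)"
  by (rule bounded_linear_intro[where K = "norm y"])
     (simp_all add: cinner_add_left cinner_scaleR_left cmod_cinner_le scaleR_conv_of_real)

lemma bounded_linear_cinner_right: "bounded_linear (cinner x)"
  by (rule bounded_linear_intro[where K = "norm x"])
     (use cmod_cinner_le[of x] in
       \<open>simp_all add: cinner_add_right cinner_scaleR_right scaleR_conv_of_real mult.commute\<close>)

lemma cinner_sum_left: "cinner (\<Sum>i\<in>I. x i) y = (\<Sum>i\<in>I. cinner (x i) y)"
  using bounded_linear.linear[OF bounded_linear_cinner_left] by (rule linear_sum)

lemma cinner_sum_right: "cinner y (\<Sum>i\<in>I. x i) = (\<Sum>i\<in>I. cinner y (x i))"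
  using bounded_linear.linear[OF bounded_linear_cinner_right] by (rule linear_sum)

lemma cinner_ext:
  assumes "\<And>y. cinner x y = cinner x' y"
  shows "x = x'"
proof -
  have "cinner (x - x') (x - x') = 0"
    using assms by (simp add: cinner_diff_left)
  then show ?thesis by (simp add: cinner_self)
qed

section \<open>Adjoint pairs\<close>

text \<open>Adjoints are exhibited and checked rather than obtained from the Riesz theorem. The
  relation alone makes both maps linear and determines each from the other, which is how the
  arbitrary choice in \<open>cadjoint\<close> gets identified.\<close>

definition adjoint_pair :: "('a::complex_inner \<Rightarrow> 'b::complex_inner) \<Rightarrow> ('b \<Rightarrow> 'a) \<Rightarrow> bool" where
  "adjoint_pair T S \<longleftrightarrow> (\<forall>x y. cinner (T x) y = cinner x (S y))"

lemma adjoint_pairD: "adjoint_pair T S \<Longrightarrow> cinner (T x) y = cinner x (S y)"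
  by (simp add: adjoint_pair_def)

lemma adjoint_pair_sym: "adjoint_pair T S \<Longrightarrow> adjoint_pair S T"
  unfolding adjoint_pair_def by (metis cinner_commute)

lemma adjoint_pair_compose:
  assumes "adjoint_pair T S" "adjoint_pair T' S'"
  shows "adjoint_pair (\<lambda>x. T (T' x)) (\<lambda>y. S' (S y))"
  using assms by (simp add: adjoint_pair_def)

lemma adjoint_pair_unique:
  assumes "adjoint_pair T S" "adjoint_pair T S'"
  shows "S = S'"
proof (intro ext cinner_ext)
  fix x y
  show "cinner (S y) x = cinner (S' y) x"
    using assms[THEN adjoint_pair_sym] by (simp add: adjoint_pairD)
qed

lemma cadjoint_eqI: "adjoint_pair T S \<Longrightarrow> cadjoint T = S"
  unfolding cadjoint_def
  by (rule some_equality) (auto simp: adjoint_pair_def[symmetric] intro: adjoint_pair_unique)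

lemma bounded_clinearI:
  assumes "\<And>x y. T (x + y) = T x + T y" "\<And>c x. T (c *\<^sub>C x) = c *\<^sub>C T x"
    and "\<And>x. norm (T x) \<le> K * norm x"
  shows "bounded_clinear T"
  unfolding bounded_clinear_def
proof
  show "bounded_linear T"
  proof (rule bounded_linear_intro[where K = K])
    show "T (r *\<^sub>R x) = r *\<^sub>R T x" for r x
      using assms(2)[of "complex_of_real r" x] by (simp only: scaleC_of_real)
  qed (use assms in \<open>simp_all add: mult.commute\<close>)
qed (use assms in blast)

lemma bounded_clinear_add: "bounded_clinear T \<Longrightarrow> T (x + y) = T x + T y"
  by (simp add: bounded_clinear_def linear_simps)

lemma bounded_clinear_diff: "bounded_clinear T \<Longrightarrow> T (x - y) = T x - T y"
  by (simp add: bounded_clinear_def linear_simps)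

lemma bounded_clinear_zero: "bounded_clinear T \<Longrightarrow> T 0 = 0"
  by (simp add: bounded_clinear_def linear_simps)

lemma bounded_clinear_scaleC: "bounded_clinear T \<Longrightarrow> T (c *\<^sub>C x) = c *\<^sub>C T x"
  by (simp add: bounded_clinear_def)

lemma bounded_clinear_scaleR: "bounded_clinear T \<Longrightarrow> T (r *\<^sub>R x) = r *\<^sub>R T x"
  by (simp add: bounded_clinear_def linear_simps)

lemma bounded_clinear_bound:
  assumes "bounded_clinear T"
  obtains K where "K > 0" "\<And>x. norm (T x) \<le> K * norm x"
  using assms bounded_linear.pos_bounded unfolding bounded_clinear_def by (metis mult.commute)

lemma bounded_clinear_compose:
  assumes "bounded_clinear T" "bounded_clinear S"
  shows "bounded_clinear (\<lambda>x. T (S x))"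
  using assms unfolding bounded_clinear_def by (simp add: bounded_linear_compose)

lemma adjoint_pair_additive:
  assumes "adjoint_pair T S"
  shows "T (x + y) = T x + T y"
  by (rule cinner_ext) (simp add: adjoint_pairD[OF assms] cinner_add_left)

lemma adjoint_pair_diff:
  assumes "adjoint_pair T S"
  shows "T (x - y) = T x - T y"
  by (rule cinner_ext) (simp add: adjoint_pairD[OF assms] cinner_diff_left)

lemma adjoint_pair_scaleC:
  assumes "adjoint_pair T S"
  shows "T (c *\<^sub>C x) = c *\<^sub>C T x"
  by (rule cinner_ext) (simp add: adjoint_pairD[OF assms] cinner_scaleC_left)

lemma adjoint_pair_scaleR:
  assumes "adjoint_pair T S"
  shows "T (r *\<^sub>R x) = r *\<^sub>R T x"
  by (rule cinner_ext) (simp add: adjoint_pairD[OF assms] cinner_scaleR_left)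

text \<open>|T x|^2 = <x, S (T x)> is at most |x| K |T x|, so a bound for \<open>S\<close> is also
  one for \<open>T\<close> after cancelling |T x|.\<close>

lemma adjoint_pair_bounded_clinear:
  assumes adj: "adjoint_pair T S" and "0 \<le> K" and S: "\<And>y. norm (S y) \<le> K * norm y"
  shows "bounded_clinear T"
proof (rule bounded_clinearI)
  show "T (x + y) = T x + T y" for x y
    using adj by (rule adjoint_pair_additive)
  show "T (c *\<^sub>C x) = c *\<^sub>C T x" for c x
    using adj by (rule adjoint_pair_scaleC)
  show "norm (T x) \<le> K * norm x" for x
  proof -
    have "(norm (T x))\<^sup>2 = cmod (cinner x (S (T x)))"
      by (simp add: adjoint_pairD[OF adj, symmetric] cinner_self norm_power)
    also have "\<dots> \<le> norm x * (K * norm (T x))"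
      by (rule order_trans[OF cmod_cinner_le]) (simp add: S mult_left_mono)
    finally have "norm (T x) * norm (T x) \<le> norm (T x) * (K * norm x)"
      by (simp add: power2_eq_square mult_ac)
    then show ?thesis
      using \<open>0 \<le> K\<close> by (cases "norm (T x) = 0") (auto simp: mult_le_cancel_left)
  qed
qed

section \<open>Bessel sequences\<close>

text \<open>This is the upper half of the frame condition. Bounding partial sums makes summability a
  consequence instead of a separate requirement.\<close>

definition bessel :: "(nat \<Rightarrow> 'h::complex_inner) \<Rightarrow> real \<Rightarrow> bool" where
  "bessel f B \<longleftrightarrow> 0 \<le> B \<and> (\<forall>h n. (\<Sum>i<n. (cmod (cinner h (f i)))\<^sup>2) \<le> B * (norm h)\<^sup>2)"

definition analysis :: "(nat \<Rightarrow> 'h::complex_inner) \<Rightarrow> 'h \<Rightarrow> ell2" where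
  "analysis f h = Abs_ell2 (\<lambda>i. cinner h (f i))"

lemma bessel_sum_le: "bessel f B \<Longrightarrow> (\<Sum>i<n. (cmod (cinner h (f i)))\<^sup>2) \<le> B * (norm h)\<^sup>2"
  by (simp add: bessel_def)

lemma bessel_summable:
  assumes "bessel f B"
  shows "summable (\<lambda>i. (cmod (cinner h (f i)))\<^sup>2)"
  by (rule summableI_nonneg_bounded[OF _ bessel_sum_le[OF assms]]) simp

lemma ell2_coord_analysis:
  "bessel f B \<Longrightarrow> ell2_coord (analysis f h) i = cinner h (f i)"
  by (simp add: analysis_def Abs_ell2_inverse bessel_summable)

lemma norm_analysis:
  "bessel f B \<Longrightarrow> (norm (analysis f h))\<^sup>2 = (\<Sum>i. (cmod (cinner h (f i)))\<^sup>2)"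
  by (simp add: norm_ell2 ell2_coord_analysis)

lemma norm_analysis_le:
  assumes "bessel f B"
  shows "norm (analysis f h) \<le> sqrt B * norm h"
proof (rule power2_le_imp_le)
  have "0 \<le> B" using assms by (simp add: bessel_def)
  then show "0 \<le> sqrt B * norm h" by simp
  have "(norm (analysis f h))\<^sup>2 \<le> B * (norm h)\<^sup>2"
    unfolding norm_analysis[OF assms]
    by (intro suminf_le_const bessel_summable[OF assms] bessel_sum_le[OF assms])
  then show "(norm (analysis f h))\<^sup>2 \<le> (sqrt B * norm h)\<^sup>2"
    using \<open>0 \<le> B\<close> by (simp add: power_mult_distrib)
qed

text \<open>Pair the finite sum \<open>s\<close> with itself: |s|^2 is the sum of the products of
  the conjugated coefficients with <s, f i>. Cauchy-Schwarz and the Bessel bound for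
  \<open>s\<close> give a factor |s|, which cancels. Allowing a general lower index yields the
  Cauchy criterion for the synthesis series.\<close>

lemma norm_bessel_sum_le:
  assumes "bessel f B"
  shows "norm (\<Sum>i=m..<n. c i *\<^sub>C f i) \<le> sqrt B * sqrt (\<Sum>i=m..<n. (cmod (c i))\<^sup>2)"
proof -
  define s where "s = (\<Sum>i=m..<n. c i *\<^sub>C f i)"
  have "0 \<le> B" using assms by (simp add: bessel_def)
  have "(\<Sum>i=m..<n. (cmod (cinner s (f i)))\<^sup>2) \<le> (\<Sum>i<n. (cmod (cinner s (f i)))\<^sup>2)"
    by (intro sum_mono2) auto
  also have "\<dots> \<le> B * (norm s)\<^sup>2" by (rule bessel_sum_le[OF assms])
  finally have "sqrt (\<Sum>i=m..<n. (cmod (cinner s (f i)))\<^sup>2) \<le> sqrt (B * (norm s)\<^sup>2)"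
    by (rule real_sqrt_le_mono)
  then have L2: "L2_set (\<lambda>i. cmod (cinner s (f i))) {m..<n} \<le> sqrt B * norm s"
    unfolding L2_set_def by (simp add: real_sqrt_mult)
  have "(norm s)\<^sup>2 = cmod (\<Sum>i=m..<n. cnj (c i) * cinner s (f i))"
    by (simp only: cinner_scaleC_right[symmetric] cinner_sum_right[symmetric] s_def[symmetric])
       (simp add: cinner_self norm_power)
  also have "\<dots> \<le> (\<Sum>i=m..<n. \<bar>cmod (c i)\<bar> * \<bar>cmod (cinner s (f i))\<bar>)"
    by (rule order_trans[OF norm_sum]) (simp add: norm_mult)
  also have "\<dots> \<le> L2_set (\<lambda>i. cmod (c i)) {m..<n} * L2_set (\<lambda>i. cmod (cinner s (f i))) {m..<n}"
    by (rule L2_set_mult_ineq)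
  also have "\<dots> \<le> L2_set (\<lambda>i. cmod (c i)) {m..<n} * (sqrt B * norm s)"
    by (intro mult_left_mono L2 L2_set_nonneg)
  finally have "norm s * norm s \<le> norm s * (sqrt B * L2_set (\<lambda>i. cmod (c i)) {m..<n})"
    by (simp add: power2_eq_square mult_ac)
  moreover have "0 \<le> sqrt B * L2_set (\<lambda>i. cmod (c i)) {m..<n}"
    using \<open>0 \<le> B\<close> by (simp add: L2_set_nonneg)
  ultimately have "norm s \<le> sqrt B * L2_set (\<lambda>i. cmod (c i)) {m..<n}"
    by (cases "norm s = 0") (auto simp: mult_le_cancel_left)
  then show ?thesis by (simp add: s_def L2_set_def)
qed

lemma bessel_summable_synthesis:
  fixes f :: "nat \<Rightarrow> 'h::chilbert_space"
  assumes "bessel f B"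
  shows "summable (\<lambda>i. ell2_coord a i *\<^sub>C f i)"
  unfolding summable_Cauchy
proof (intro allI impI)
  fix e :: real assume "0 < e"
  \<comment> \<open>The added 1 keeps the denominator positive when \<open>B = 0\<close> and makes
    the final comparison with \<open>e\<close> strict.\<close>
  define d where "d = (e / (sqrt B + 1))\<^sup>2"
  have "0 \<le> sqrt B" using assms by (simp add: bessel_def)
  then have "0 < d" using \<open>0 < e\<close> by (simp add: d_def add_nonneg_eq_0_iff)
  then obtain N where N: "\<And>m n. m \<ge> N \<Longrightarrow> norm (\<Sum>i=m..<n. (cmod (ell2_coord a i))\<^sup>2) < d"
    using summable_ell2[of a] unfolding summable_Cauchy by blast
  have "norm (\<Sum>i=m..<n. ell2_coord a i *\<^sub>C f i) < e" if "m \<ge> N" for m n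
  proof -
    have "(\<Sum>i=m..<n. (cmod (ell2_coord a i))\<^sup>2) \<le> d"
      using N[OF that, of n] by simp
    then have "sqrt (\<Sum>i=m..<n. (cmod (ell2_coord a i))\<^sup>2) \<le> e / (sqrt B + 1)"
      using \<open>0 < e\<close> \<open>0 \<le> sqrt B\<close> by (intro real_le_lsqrt) (simp_all add: d_def sum_nonneg)
    then have "sqrt B * sqrt (\<Sum>i=m..<n. (cmod (ell2_coord a i))\<^sup>2) \<le> sqrt B * (e / (sqrt B + 1))"
      using \<open>0 \<le> sqrt B\<close> by (rule mult_left_mono)
    also have "\<dots> < e"
    proof -
      have "0 < sqrt B + 1" using \<open>0 \<le> sqrt B\<close> by linarith
      then show ?thesis using \<open>0 < e\<close> by (simp add: pos_divide_less_eq algebra_simps)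
    qed
    finally show ?thesis
      using norm_bessel_sum_le[OF assms, where c = "ell2_coord a"] order_le_less_trans by blast
  qed
  then show "\<exists>N. \<forall>m\<ge>N. \<forall>n. norm (\<Sum>i=m..<n. ell2_coord a i *\<^sub>C f i) < e" by blast
qed

lemma adjoint_pair_synthesis:
  fixes f :: "nat \<Rightarrow> 'h::chilbert_space"
  assumes "bessel f B"
  shows "adjoint_pair (synthesis f) (analysis f)"
  unfolding adjoint_pair_def
proof (intro allI)
  fix a h
  have "cinner (synthesis f a) h = (\<Sum>i. cinner (ell2_coord a i *\<^sub>C f i) h)"
    unfolding synthesis_def
    by (rule bounded_linear.suminf[OF bounded_linear_cinner_left bessel_summable_synthesis[OF assms]])
  also have "\<dots> = (\<Sum>i. ell2_coord a i * cnj (cinner h (f i)))"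
    by (simp add: cinner_scaleC_left flip: cinner_commute)
  finally show "cinner (synthesis f a) h = cinner a (analysis f h)"
    by (simp add: cinner_ell2_def ell2_coord_analysis[OF assms])
qed

lemma bounded_clinear_synthesis:
  fixes f :: "nat \<Rightarrow> 'h::chilbert_space"
  assumes "bessel f B"
  shows "bounded_clinear (synthesis f)"
proof (rule adjoint_pair_bounded_clinear[OF adjoint_pair_synthesis[OF assms]])
  show "0 \<le> sqrt B" using assms by (simp add: bessel_def)
qed (rule norm_analysis_le[OF assms])

section \<open>Orthonormal sequences\<close>

definition orthonormal :: "(nat \<Rightarrow> 'h::complex_inner) \<Rightarrow> bool" where
  "orthonormal u \<longleftrightarrow> (\<forall>m n. cinner (u m) (u n) = (if m = n then 1 else 0))"

text \<open>Let \<open>p\<close> be the finite combination of the \<open>u i\<close> with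
  coefficients <h, X (u i)>. Both |p|^2 and <h, X p> equal the partial sum \<open>s\<close>, so
  |p|^2 is at most |h| K |p|. The identity operator gives Bessel's inequality; a general
  \<open>X\<close> on \<open>ell2\<close> leads to its adjoint.\<close>

lemma bessel_orthonormal_image:
  assumes u: "orthonormal u" and X: "bounded_clinear X"
    and K: "0 \<le> K" "\<And>x. norm (X x) \<le> K * norm x"
  shows "bessel (\<lambda>i. X (u i)) (K\<^sup>2)"
  unfolding bessel_def
proof (intro conjI allI)
  fix h n
  define c where "c i = cinner h (X (u i))" for i
  define s where "s = (\<Sum>i<n. (cmod (c i))\<^sup>2)"
  define p where "p = (\<Sum>i<n. c i *\<^sub>C u i)"
  have s: "complex_of_real s = (\<Sum>i<n. cnj (c i) * c i)"
    by (simp add: s_def complex_norm_square mult.commute del: of_real_power)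
  have "cinner p (u j) = c j" if "j < n" for j
  proof -
    have "cinner p (u j) = (\<Sum>i<n. if i = j then c i else 0)"
      unfolding p_def cinner_sum_left cinner_scaleC_left
      using u by (intro sum.cong) (simp_all add: orthonormal_def)
    then show ?thesis using that by simp
  qed
  then have "cinner p p = complex_of_real s"
    unfolding s by (subst (2) p_def) (simp add: cinner_sum_right cinner_scaleC_right)
  then have p: "(norm p)\<^sup>2 = s"
    unfolding cinner_self using of_real_eq_iff by blast
  have "X p = (\<Sum>i<n. c i *\<^sub>C X (u i))"
    using X unfolding p_def bounded_clinear_def
    by (simp add: linear_sum bounded_linear.linear)
  then have "cinner h (X p) = complex_of_real s"
    unfolding s by (simp add: cinner_sum_right cinner_scaleC_right c_def)
  then have "s \<le> cmod (cinner h (X p))" by simp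
  also have "\<dots> \<le> norm h * (K * norm p)"
    by (rule order_trans[OF cmod_cinner_le]) (simp add: K mult_left_mono)
  finally have "norm p * norm p \<le> norm p * (K * norm h)"
    by (simp add: p[symmetric] power2_eq_square mult_ac)
  then have "norm p \<le> K * norm h"
    using \<open>0 \<le> K\<close> by (cases "norm p = 0") (auto simp: mult_le_cancel_left)
  then have "s \<le> (K * norm h)\<^sup>2"
    unfolding p[symmetric] by (rule power_mono) simp
  then show "(\<Sum>i<n. (cmod (cinner h (X (u i))))\<^sup>2) \<le> K\<^sup>2 * (norm h)\<^sup>2"
    by (simp add: s_def c_def power_mult_distrib)
qed simp

lemma bessel_orthonormal:
  assumes "orthonormal u"
  shows "bessel u 1"
  using bessel_orthonormal_image[OF assms, of "\<lambda>x. x" 1]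
  by (simp add: bounded_clinear_def)

section \<open>Coordinates in the sequence space, existence of adjoints, and orthonormal sequences
  in subspaces\<close>

definition ell2_unit :: "nat \<Rightarrow> ell2" where
  "ell2_unit n = Abs_ell2 (\<lambda>i. if i = n then 1 else 0)"

lemma ell2_coord_unit: "ell2_coord (ell2_unit n) i = (if i = n then 1 else 0)"
proof -
  have "summable (\<lambda>i. (cmod (if i = n then 1 else 0))\<^sup>2)"
    by (rule summable_finite[of "{n}"]) auto
  then show ?thesis by (simp add: ell2_unit_def Abs_ell2_inverse)
qed

lemma cinner_ell2_unit: "cinner a (ell2_unit n) = ell2_coord a n"
proof -
  have "cinner a (ell2_unit n) = (\<Sum>i\<in>{n}. ell2_coord a i * cnj (ell2_coord (ell2_unit n) i))"
    unfolding cinner_ell2_def by (rule suminf_finite) (simp_all add: ell2_coord_unit)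
  then show ?thesis by (simp add: ell2_coord_unit)
qed

lemma orthonormal_ell2_unit: "orthonormal ell2_unit"
  by (auto simp: orthonormal_def cinner_ell2_unit ell2_coord_unit)

lemma ell2_eqI: "(\<And>i. ell2_coord a i = ell2_coord b i) \<Longrightarrow> a = b"
  by (simp add: ell2_coord_inject[symmetric] fun_eq_iff)

text \<open>Moving the synthesis operator across the inner product, the j-th coordinate is the
  pairing of \<open>a\<close> with the coefficients of \<open>u j\<close>, which form the j-th unit
  vector.\<close>

lemma analysis_synthesis_orthonormal:
  fixes u :: "nat \<Rightarrow> 'h::chilbert_space"
  assumes "orthonormal u"
  shows "analysis u (synthesis u a) = a"
proof (rule ell2_eqI)
  fix j
  note bessel = bessel_orthonormal[OF assms]
  have "analysis u (u j) = ell2_unit j"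
    using assms
    by (intro ell2_eqI) (auto simp: ell2_coord_analysis[OF bessel] ell2_coord_unit orthonormal_def)
  then show "ell2_coord (analysis u (synthesis u a)) j = ell2_coord a j"
    by (simp add: ell2_coord_analysis[OF bessel] adjoint_pairD[OF adjoint_pair_synthesis[OF bessel]]
        cinner_ell2_unit)
qed

lemma synthesis_ell2_unit: "synthesis ell2_unit a = a"
proof (rule ell2_eqI)
  show "ell2_coord (synthesis ell2_unit a) i = ell2_coord a i" for i
    using analysis_synthesis_orthonormal[OF orthonormal_ell2_unit, of a]
    by (metis bessel_orthonormal orthonormal_ell2_unit ell2_coord_analysis cinner_ell2_unit)
qed

text \<open>By continuity \<open>X\<close> is the synthesis operator of the Bessel sequence of
  images of the unit vectors, so the matching analysis operator is an adjoint. Uniqueness identifies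
  it with \<open>cadjoint X\<close>.\<close>

lemma adjoint_pair_cadjoint:
  fixes X :: "ell2 \<Rightarrow> 'h::chilbert_space"
  assumes X: "bounded_clinear X"
  shows "adjoint_pair X (cadjoint X)"
proof -
  obtain K where K: "0 < K" "\<And>x. norm (X x) \<le> K * norm x"
    using X bounded_clinear_bound by blast
  have bessel: "bessel (\<lambda>i. X (ell2_unit i)) (K\<^sup>2)"
    using K by (intro bessel_orthonormal_image[OF orthonormal_ell2_unit X]) simp_all
  have "X a = synthesis (\<lambda>i. X (ell2_unit i)) a" for a
  proof -
    have "X (synthesis ell2_unit a) = (\<Sum>i. X (ell2_coord a i *\<^sub>C ell2_unit i))"
      unfolding synthesis_def using X unfolding bounded_clinear_def
      by (intro bounded_linear.suminf
          bessel_summable_synthesis[OF bessel_orthonormal[OF orthonormal_ell2_unit]]) simp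
    then show ?thesis
      using X by (simp add: synthesis_ell2_unit bounded_clinear_scaleC)
         (simp add: synthesis_def)
  qed
  then have "X = synthesis (\<lambda>i. X (ell2_unit i))" by blast
  then have "adjoint_pair X (analysis (\<lambda>i. X (ell2_unit i)))"
    using adjoint_pair_synthesis[OF bessel] by simp
  then show ?thesis using cadjoint_eqI by metis
qed

text \<open>Gram-Schmidt: a finite orthonormal subset never spans \<open>N\<close>, so some vector
  of \<open>N\<close> has a nonzero remainder after its projection onto the span is subtracted;
  normalizing it extends the set.\<close>

lemma infinite_cdim_orthonormal:
  fixes N :: "'h::complex_inner set"
  assumes N: "complex_vector.subspace N" and inf: "infinite_cdim N"
  obtains u where "orthonormal u" "\<And>n. u n \<in> N"
proof -
  define ON where "ON B \<longleftrightarrow> finite B \<and> B \<subseteq> N \<and>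
      (\<forall>x\<in>B. \<forall>y\<in>B. cinner x y = (if x = y then 1 else 0))" for B
  have step: "\<exists>v. v \<in> N \<and> cinner v v = 1 \<and> (\<forall>b\<in>B. cinner v b = 0)" if B: "ON B" for B
  proof -
    have "complex_vector.span B \<subseteq> N"
      using B N by (intro complex_vector.span_minimal) (simp_all add: ON_def)
    moreover have "complex_vector.span B \<noteq> N"
      using B inf unfolding ON_def infinite_cdim_def by blast
    ultimately obtain x where x: "x \<in> N" "x \<notin> complex_vector.span B" by blast
    define p where "p = (\<Sum>b\<in>B. cinner x b *\<^sub>C b)"
    have p: "p \<in> complex_vector.span B"
      unfolding p_def
      by (intro complex_vector.span_sum complex_vector.span_scale complex_vector.span_base)
    then have "p \<in> N" using \<open>complex_vector.span B \<subseteq> N\<close> by blast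
    then have y: "x - p \<in> N" "x - p \<noteq> 0"
      using x p complex_vector.subspace_diff[OF N] by auto
    have orth: "cinner (x - p) b = 0" if "b \<in> B" for b
    proof -
      have "cinner p b = (\<Sum>b'\<in>B. if b' = b then cinner x b' else 0)"
        unfolding p_def cinner_sum_left cinner_scaleC_left
        using B that by (intro sum.cong) (simp_all add: ON_def)
      also have "\<dots> = cinner x b" using B that by (simp add: ON_def)
      finally show ?thesis by (simp add: cinner_diff_left)
    qed
    define v where "v = complex_of_real (1 / norm (x - p)) *\<^sub>C (x - p)"
    have "norm v = 1" using y by (simp add: v_def norm_scaleC norm_divide)
    then have "cinner v v = 1" by (simp add: cinner_self)
    moreover have "v \<in> N" unfolding v_def using y by (intro complex_vector.subspace_scale[OF N])
    ultimately show ?thesis using orth by (auto simp: v_def cinner_scaleC_left)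
  qed
  \<comment> \<open>The recursion runs over finite sets. The vector adjoined at stage
    \<open>n\<close> is orthogonal to \<open>B n\<close>, which contains all vectors adjoined
    earlier.\<close>
  have "\<exists>B. \<forall>n. ON (B n) \<and> (\<exists>v. v \<in> N \<and> cinner v v = 1 \<and> (\<forall>b\<in>B n. cinner v b = 0)
      \<and> B (Suc n) = insert v (B n))"
  proof (rule dependent_nat_choice)
    show "\<exists>B. ON B" by (rule exI[of _ "{}"]) (simp add: ON_def)
    fix B :: "'h set" and n :: nat assume B: "ON B"
    then obtain v where v: "v \<in> N" "cinner v v = 1" "\<forall>b\<in>B. cinner v b = 0"
      using step by blast
    then have "\<forall>b\<in>B. cinner b v = 0"
      by (metis cinner_commute complex_cnj_zero)
    with v B have "ON (insert v B)" by (auto simp: ON_def)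
    with v show "\<exists>B'. ON B' \<and> (\<exists>v. v \<in> N \<and> cinner v v = 1 \<and> (\<forall>b\<in>B. cinner v b = 0)
      \<and> B' = insert v B)" by blast
  qed
  then obtain B u where u: "\<And>n. u n \<in> N" "\<And>n. cinner (u n) (u n) = 1"
    "\<And>n b. b \<in> B n \<Longrightarrow> cinner (u n) b = 0" and B: "\<And>n. B (Suc n) = insert (u n) (B n)"
    by metis
  have "u m \<in> B n" if "m < n" for m n
    using that by (induction n) (auto simp: B less_Suc_eq)
  then have "cinner (u n) (u m) = 0" if "m < n" for m n
    using u that by blast
  then have "orthonormal u"
    using u unfolding orthonormal_def by (metis cinner_commute complex_cnj_zero linorder_neqE_nat)
  then show ?thesis using u that by blast
qed

section \<open>Inverting bounded operators\<close>

text \<open>The solution of \<open>T x = y\<close> is the fixed point of the map sending x to x - t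
  (T x - y), a contraction by the hypothesis on \<open>q\<close>. The factor \<open>t\<close> lets
  this apply to operators that are close to the identity only after rescaling.\<close>

lemma near_identity_invertible:
  fixes T :: "'h::chilbert_space \<Rightarrow> 'h"
  assumes T: "bounded_clinear T" and "t > 0" "q < 1"
    and near: "\<And>x. norm (x - t *\<^sub>R T x) \<le> q * norm x"
  obtains R where "bounded_clinear R" "\<And>x. T (R x) = x" "\<And>x. R (T x) = x"
proof -
  have "\<exists>!x. x - t *\<^sub>R (T x - y) = x" for y
  proof (rule banach_fix_type)
    \<comment> \<open>The fixed point theorem wants a nonnegative constant, while \<open>q\<close>
      is only known to be below 1.\<close>
    show "0 \<le> max q 0" "max q 0 < 1" using \<open>q < 1\<close> by auto
    show "\<forall>x x'. dist (x - t *\<^sub>R (T x - y)) (x' - t *\<^sub>R (T x' - y)) \<le> max q 0 * dist x x'"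
    proof (intro allI)
      fix x x'
      have "dist (x - t *\<^sub>R (T x - y)) (x' - t *\<^sub>R (T x' - y))
          = norm ((x - x') - t *\<^sub>R T (x - x'))"
        by (simp add: dist_norm bounded_clinear_diff[OF T] algebra_simps)
      also have "\<dots> \<le> q * norm (x - x')" by (rule near)
      also have "\<dots> \<le> max q 0 * norm (x - x')" by (intro mult_right_mono) auto
      finally show "dist (x - t *\<^sub>R (T x - y)) (x' - t *\<^sub>R (T x' - y)) \<le> max q 0 * dist x x'"
        by (simp add: dist_norm)
    qed
  qed
  moreover have "x - t *\<^sub>R (T x - y) = x \<longleftrightarrow> T x = y" for x y
    using \<open>t > 0\<close> by simp
  ultimately have ex1: "\<exists>!x. T x = y" for y by simp
  define R where "R y = (THE x. T x = y)" for y
  have TR: "T (R y) = y" for y unfolding R_def by (rule theI'[OF ex1])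
  have RT: "R (T x) = x" for x unfolding R_def using ex1 by blast
  have "norm (R y) \<le> (t / (1 - q)) * norm y" for y
  proof -
    have "norm (R y) \<le> norm (R y - t *\<^sub>R T (R y)) + norm (t *\<^sub>R T (R y))"
      using norm_triangle_ineq[of "R y - t *\<^sub>R T (R y)" "t *\<^sub>R T (R y)"] by simp
    also have "\<dots> \<le> q * norm (R y) + t * norm y"
      using near[of "R y"] \<open>t > 0\<close> by (simp add: TR)
    finally show ?thesis using \<open>q < 1\<close> by (simp add: field_simps)
  qed
  moreover have "R (x + y) = R x + R y" for x y
    using RT[of "R x + R y"] by (simp add: bounded_clinear_add[OF T] TR)
  moreover have "R (a *\<^sub>C x) = a *\<^sub>C R x" for a x
    using RT[of "a *\<^sub>C R x"] by (simp add: bounded_clinear_scaleC[OF T] TR)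
  ultimately have "bounded_clinear R" by (intro bounded_clinearI)
  then show ?thesis using that TR RT by blast
qed

section \<open>Positive contractions\<close>

definition positive_contraction :: "('h::complex_inner \<Rightarrow> 'h) \<Rightarrow> bool" where
  "positive_contraction P \<longleftrightarrow>
    adjoint_pair P P \<and> (\<forall>x. 0 \<le> inner (P x) x \<and> inner (P x) x \<le> (norm x)\<^sup>2)"

text \<open>This is the operator inequality saying that the square of \<open>P\<close> lies below
  \<open>P\<close>. It comes from positivity at x - P x together with the contraction bound at P
  x.\<close>

lemma positive_contraction_norm_le:
  assumes P: "positive_contraction P"
  shows "(norm (P x))\<^sup>2 \<le> inner (P x) x" "norm (P x) \<le> norm x"
proof -
  have adj: "adjoint_pair P P" using P by (simp add: positive_contraction_def)
  have sym: "inner (P a) b = inner a (P b)" for a b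
    using arg_cong[OF adjoint_pairD[OF adj], of Re a b] by (simp add: Re_cinner)
  have "0 \<le> inner (P (x - P x)) (x - P x)"
    using P by (simp add: positive_contraction_def)
  also have "\<dots> = inner (P x) x - 2 * inner (P x) (P x) + inner (P (P x)) (P x)"
    by (simp add: adjoint_pair_diff[OF adj] inner_diff_left inner_diff_right)
       (simp add: sym inner_commute)
  also have "\<dots> \<le> inner (P x) x - 2 * inner (P x) (P x) + (norm (P x))\<^sup>2"
    using P by (simp add: positive_contraction_def)
  finally show le: "(norm (P x))\<^sup>2 \<le> inner (P x) x"
    by (simp add: power2_norm_eq_inner)
  also have "\<dots> \<le> norm (P x) * norm x" by (rule norm_cauchy_schwarz)
  finally show "norm (P x) \<le> norm x"
    by (cases "P x = 0") (auto simp: power2_eq_square)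
qed

text \<open>One step of a Cholesky factorization of \<open>P\<close>. If \<open>P d = 0\<close>, the vector is \<open>0\<close> because \<open>1 / 0 = 0\<close>.\<close>

definition pivot :: "('h::complex_inner \<Rightarrow> 'h) \<Rightarrow> 'h \<Rightarrow> 'h" where
  "pivot P d = (1 / sqrt (inner (P d) d)) *\<^sub>R P d"

definition deflate :: "('h::complex_inner \<Rightarrow> 'h) \<Rightarrow> 'h \<Rightarrow> 'h \<Rightarrow> 'h" where
  "deflate P d x = P x - cinner x (pivot P d) *\<^sub>C pivot P d"

lemma inner_deflate:
  "inner (deflate P d x) x = inner (P x) x - (cmod (cinner x (pivot P d)))\<^sup>2"
proof -
  have "inner (cinner x g *\<^sub>C g) x = (cmod (cinner x g))\<^sup>2" for g
  proof -
    have "cinner (cinner x g *\<^sub>C g) x = cinner x g * cnj (cinner x g)"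
      by (simp add: cinner_scaleC_left flip: cinner_commute)
    then show ?thesis
      by (metis Re_cinner Re_complex_of_real complex_norm_square)
  qed
  then show ?thesis by (simp add: deflate_def inner_diff_left)
qed

text \<open>The subtracted rank-one form is the largest one supported by the direction
  \<open>d\<close>: Cauchy-Schwarz for the form <P x, y> keeps the remainder positive, with equality
  at \<open>d\<close>. The kernel of \<open>P\<close> is preserved, so directions removed earlier
  stay removed.\<close>

lemma positive_contraction_deflate:
  assumes P: "positive_contraction P"
  shows "positive_contraction (deflate P d)" "deflate P d d = 0"
    and "P x = 0 \<Longrightarrow> deflate P d x = 0"
proof -
  have adj: "adjoint_pair P P" using P by (simp add: positive_contraction_def)
  define s where "s = inner (P d) d"
  define g where "g = pivot P d"
  have "s \<ge> 0" using P by (simp add: s_def positive_contraction_def)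
  have g: "g = (1 / sqrt s) *\<^sub>R P d" by (simp add: g_def pivot_def s_def)
  have xg: "cinner x g = complex_of_real (1 / sqrt s) * cinner (P x) d" for x
    by (simp only: g cinner_scaleR_right adjoint_pairD[OF adj])
  have Pdd: "cinner (P d) d = complex_of_real s"
  proof -
    have "Im (cinner (P d) d) = Im (cnj (cinner (P d) d))"
      using adjoint_pairD[OF adj, of d d] cinner_commute by metis
    then show ?thesis by (simp add: complex_eq_iff s_def Re_cinner)
  qed
  have cs: "(cmod (cinner (P x) d))\<^sup>2 \<le> s * inner (P x) x" for x
  proof (cases "s = 0")
    case True
    then have "P d = 0" using positive_contraction_norm_le(1)[OF P, of d] by (simp add: s_def)
    then show ?thesis using True by (simp add: adjoint_pairD[OF adj])
  next
    case False
    define z where "z = cinner (P x) d"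
    \<comment> \<open>Up to the factor \<open>s\<close>, this is \<open>x\<close> minus its
      projection along \<open>d\<close> with respect to the form <P x, y>; positivity at
      \<open>v\<close> is the Cauchy-Schwarz inequality.\<close>
    define v where "v = complex_of_real s *\<^sub>C x - z *\<^sub>C d"
    have dx: "cinner (P d) x = cnj z"
      by (metis adjoint_pairD[OF adj] cinner_commute z_def)
    have Px: "Re (cinner (P x) x) = inner (P x) x" by (rule Re_cinner)
    have "0 \<le> Re (cinner (P v) v)" using P by (simp add: Re_cinner positive_contraction_def)
    also have "cinner (P v) v = s\<^sup>2 * cinner (P x) x - s * (z * cnj z)"
      by (simp add: v_def adjoint_pair_diff[OF adj] adjoint_pair_scaleC[OF adj] cinner_diff_left
          cinner_diff_right cinner_scaleC_left cinner_scaleC_right Pdd dx flip: z_def)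
         (simp add: algebra_simps power2_eq_square)
    also have "Re \<dots> = s * (s * inner (P x) x - (cmod z)\<^sup>2)"
      by (simp add: Px[symmetric] cmod_power2) (simp add: algebra_simps power2_eq_square)
    finally show ?thesis using False \<open>s \<ge> 0\<close> by (simp add: zero_le_mult_iff z_def)
  qed
  show "deflate P d d = 0"
  proof (cases "s = 0")
    case True
    then have "P d = 0" using positive_contraction_norm_le(1)[OF P, of d] by (simp add: s_def)
    then show ?thesis by (simp add: deflate_def pivot_def)
  next
    case False
    have "cinner d g = complex_of_real (1 / sqrt s * s)" unfolding xg Pdd by simp
    then have "cinner d g *\<^sub>C g = (1 / sqrt s * s) *\<^sub>R g" by (simp only: scaleC_of_real)
    also have "\<dots> = (1 / sqrt s * s * (1 / sqrt s)) *\<^sub>R P d" by (simp add: g)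
    also have "1 / sqrt s * s * (1 / sqrt s) = 1" using False \<open>s \<ge> 0\<close> by simp
    finally show ?thesis by (simp add: deflate_def flip: g_def)
  qed
  show "deflate P d x = 0" if "P x = 0"
    using that by (simp add: deflate_def xg flip: g_def)
  show "positive_contraction (deflate P d)"
    unfolding positive_contraction_def
  proof (intro conjI allI)
    show "adjoint_pair (deflate P d) (deflate P d)"
      unfolding adjoint_pair_def deflate_def g_def[symmetric]
      by (simp add: cinner_diff_left cinner_diff_right cinner_scaleC_left cinner_scaleC_right
          adjoint_pairD[OF adj] flip: cinner_commute)
  next
    fix x
    have "(cmod (cinner x g))\<^sup>2 = (cmod (cinner (P x) d))\<^sup>2 / s"
      using \<open>s \<ge> 0\<close> by (simp add: xg norm_mult power_mult_distrib norm_divide power_divide)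
    \<comment> \<open>For \<open>s = 0\<close> the quotient is 0 by convention, and positivity of
      \<open>P\<close> suffices.\<close>
    also have "\<dots> \<le> inner (P x) x"
      using cs[of x] \<open>s \<ge> 0\<close> P
      by (cases "s = 0") (simp_all add: field_simps positive_contraction_def)
    finally show "0 \<le> inner (deflate P d x) x"
      by (simp add: inner_deflate flip: g_def)
    show "inner (deflate P d x) x \<le> (norm x)\<^sup>2"
      using P unfolding inner_deflate positive_contraction_def
      by (meson diff_le_eq add_increasing2 order_trans zero_le_power2)
  qed
qed

primrec deflation :: "('h::complex_inner \<Rightarrow> 'h) \<Rightarrow> (nat \<Rightarrow> 'h) \<Rightarrow> nat \<Rightarrow> 'h \<Rightarrow> 'h" where
  "deflation P d 0 = P"
| "deflation P d (Suc n) = deflate (deflation P d n) (d n)"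

text \<open>Deflating along a dense sequence drives the remainder to \<open>0\<close> pointwise, since the remainders
  are contractions that vanish on more and more terms of the sequence. This replaces the square
  root of \<open>P\<close>.\<close>

lemma positive_contraction_factorization:
  fixes P :: "'h::chilbert_space \<Rightarrow> 'h"
  assumes separable: "\<exists>D :: 'h set. countable D \<and> closure D = UNIV"
    and P: "positive_contraction P"
  obtains g where "bessel g 1" "\<And>h. synthesis g (analysis g h) = P h"
proof -
  obtain D :: "'h set" where D: "countable D" "closure D = UNIV" using separable by blast
  define d where "d = from_nat_into D"
  have "D \<noteq> {}" using D by auto
  then have range_d: "range d = D" using D by (simp add: d_def range_from_nat_into)
  define Q where "Q = deflation P d"
  define g where "g n = pivot (Q n) (d n)" for n
  have Q: "positive_contraction (Q n)" for n
    by (induction n) (simp_all add: Q_def P positive_contraction_deflate)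
  have Q_Suc: "Q (Suc n) x = Q n x - cinner x (g n) *\<^sub>C g n" for n x
    by (simp add: Q_def g_def deflate_def)
  have Q_zero: "Q n (d m) = 0" if "m < n" for m n
    using that
  proof (induction n)
    case (Suc n)
    then show ?case
      using positive_contraction_deflate(2,3)[OF Q[of n]] by (cases "m = n") (simp_all add: Q_def)
  qed simp
  \<comment> \<open>The deflation steps telescope, for the operators here and for the quadratic
    forms next. Dropping the nonnegative remainder of the forms gives the Bessel bound 1.\<close>
  have Q_sum: "(\<Sum>i<n. cinner x (g i) *\<^sub>C g i) = P x - Q n x" for n x
    by (induction n) (simp_all add: Q_Suc, simp add: Q_def)
  have Q_inner: "(\<Sum>i<n. (cmod (cinner x (g i)))\<^sup>2) = inner (P x) x - inner (Q n x) x" for n x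
    by (induction n) (simp_all add: Q_def g_def inner_deflate)
  have bessel: "bessel g 1"
    unfolding bessel_def Q_inner
  proof (intro conjI allI)
    fix x n
    have "inner (P x) x \<le> (norm x)\<^sup>2" "0 \<le> inner (Q n x) x"
      using P Q by (simp_all add: positive_contraction_def)
    then show "inner (P x) x - inner (Q n x) x \<le> 1 * (norm x)\<^sup>2" by simp
  qed simp
  have "synthesis g (analysis g h) = P h" for h
  proof -
    have "(\<lambda>n. Q n h) \<longlonglongrightarrow> 0"
    proof (rule LIMSEQ_I)
      fix e :: real assume "0 < e"
      have "h \<in> closure (range d)" using D range_d by simp
      then obtain m where m: "dist (d m) h < e"
        using \<open>0 < e\<close> unfolding closure_approachable by blast
      have "norm (Q n h) < e" if "n \<ge> Suc m" for n
      proof -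
        have adj: "adjoint_pair (Q n) (Q n)" using Q by (simp add: positive_contraction_def)
        have "Q n h = Q n (h - d m)"
          using that by (simp add: adjoint_pair_diff[OF adj] Q_zero)
        then have "norm (Q n h) \<le> norm (h - d m)"
          using positive_contraction_norm_le(2)[OF Q] by metis
        then show ?thesis using m by (simp add: dist_norm norm_minus_commute)
      qed
      then show "\<exists>N. \<forall>n\<ge>N. norm (Q n h - 0) < e" by auto
    qed
    then have "(\<lambda>n. P h - Q n h) \<longlonglongrightarrow> P h - 0" by (intro tendsto_diff tendsto_const)
    then have "(\<lambda>i. cinner h (g i) *\<^sub>C g i) sums P h"
      by (simp add: sums_def Q_sum)
    then show ?thesis
      by (simp add: synthesis_def ell2_coord_analysis[OF bessel] sums_iff)
  qed
  then show ?thesis using that bessel by blast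
qed

section \<open>Frames\<close>

lemma frame_bounds_bessel:
  assumes "frame_bounds f A B"
  shows "bessel f B"
  unfolding bessel_def
proof (intro conjI allI)
  show "0 \<le> B" using assms by (simp add: frame_bounds_def)
  fix h n
  have "summable (\<lambda>i. (cmod (cinner h (f i)))\<^sup>2)" using assms by (simp add: frame_bounds_def)
  then have "(\<Sum>i<n. (cmod (cinner h (f i)))\<^sup>2) \<le> (\<Sum>i. (cmod (cinner h (f i)))\<^sup>2)"
    by (intro sum_le_suminf) auto
  also have "\<dots> \<le> B * (norm h)\<^sup>2" using assms by (simp add: frame_bounds_def)
  finally show "(\<Sum>i<n. (cmod (cinner h (f i)))\<^sup>2) \<le> B * (norm h)\<^sup>2" .
qed

lemma frame_bounds_le_norm_analysis:
  assumes "frame_bounds f A B"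
  shows "A * (norm h)\<^sup>2 \<le> (norm (analysis f h))\<^sup>2"
  using assms by (simp add: norm_analysis[OF frame_bounds_bessel[OF assms]] frame_bounds_def)

text \<open>\<open>GREATEST\<close> is meaningful only if the maximum is attained. It is, because
  the frame inequality is closed in the lower bound and passes to the supremum, while the upper
  bound may stay fixed. The nonzero vector makes the set of lower bounds bounded; in the zero space
  every positive number would qualify.\<close>

lemma optimal_lower_frame_bound:
  fixes f :: "nat \<Rightarrow> 'h::complex_inner"
  assumes "is_frame f" and h0: "(h0 :: 'h) \<noteq> 0"
  obtains B where "frame_bounds f (optimal_lower_frame_bound f) B"
    "\<And>A' B'. frame_bounds f A' B' \<Longrightarrow> A' \<le> optimal_lower_frame_bound f"
proof -
  obtain A0 B where AB: "frame_bounds f A0 B" using assms by (auto simp: is_frame_def)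
  define M where "M = {A. \<exists>B. frame_bounds f A B}"
  have M: "A \<le> (\<Sum>i. (cmod (cinner h (f i)))\<^sup>2) / (norm h)\<^sup>2" if "A \<in> M" "h \<noteq> 0" for A h
    using that by (auto simp: M_def frame_bounds_def field_simps)
  have ne: "M \<noteq> {}" and A0: "A0 \<in> M" using AB by (auto simp: M_def)
  have bdd: "bdd_above M" using M[OF _ h0] by (intro bdd_aboveI) blast
  have "0 < A0" using AB by (simp add: frame_bounds_def)
  then have "0 < Sup M" using cSup_upper[OF A0 bdd] by linarith
  moreover have "Sup M * (norm h)\<^sup>2 \<le> (\<Sum>i. (cmod (cinner h (f i)))\<^sup>2)" for h
  proof (cases "h = 0")
    case False
    then have "Sup M \<le> (\<Sum>i. (cmod (cinner h (f i)))\<^sup>2) / (norm h)\<^sup>2"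
      using M by (intro cSup_least[OF ne]) blast
    then show ?thesis using False by (simp add: field_simps)
  qed simp
  ultimately have SupM: "frame_bounds f (Sup M) B"
    using AB by (simp add: frame_bounds_def)
  have le: "A' \<le> Sup M" if "frame_bounds f A' B'" for A' B'
    using that cSup_upper[OF _ bdd] by (auto simp: M_def)
  have "optimal_lower_frame_bound f = Sup M"
    unfolding optimal_lower_frame_bound_def using SupM le by (intro Greatest_equality) blast+
  then show ?thesis using that SupM le by simp
qed

section \<open>Coisometries and the lower estimate of the defect\<close>

lemma norm_cadjoint_coisometry:
  fixes X :: "ell2 \<Rightarrow> 'h::chilbert_space"
  assumes "coisometry X"
  shows "norm (cadjoint X h) = norm h"
proof -
  have adj: "adjoint_pair X (cadjoint X)" and "X (cadjoint X h) = h"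
    using assms adjoint_pair_cadjoint by (auto simp: coisometry_def fun_eq_iff)
  then have "inner (cadjoint X h) (cadjoint X h) = inner h h"
    by (metis adjoint_pairD Re_cinner)
  then show ?thesis by (simp add: norm_eq_sqrt_inner)
qed

lemma bounded_clinear_cadjoint_coisometry:
  fixes X :: "ell2 \<Rightarrow> 'h::chilbert_space"
  assumes "coisometry X"
  shows "bounded_clinear (cadjoint X)"
proof (rule bounded_clinearI[where K = 1])
  have "adjoint_pair (cadjoint X) X"
    using assms adjoint_pair_cadjoint adjoint_pair_sym by (auto simp: coisometry_def)
  then show "cadjoint X (x + y) = cadjoint X x + cadjoint X y"
    and "cadjoint X (c *\<^sub>C x) = c *\<^sub>C cadjoint X x" for x y c
    by (rule adjoint_pair_additive adjoint_pair_scaleC)+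
qed (simp add: norm_cadjoint_coisometry[OF assms])

lemma bounded_linear_synthesis_defect:
  fixes f :: "nat \<Rightarrow> 'h::chilbert_space"
  assumes "bessel f B" "coisometry X"
  shows "bounded_linear (\<lambda>h. synthesis f (cadjoint X h) - h)"
  using bounded_clinear_compose[OF bounded_clinear_synthesis[OF assms(1)]
      bounded_clinear_cadjoint_coisometry[OF assms(2)]]
  by (simp add: bounded_clinear_def bounded_linear_sub bounded_linear_ident)

lemma onorm_synthesis_defect_ge:
  fixes f :: "nat \<Rightarrow> 'h::chilbert_space"
  assumes AB: "frame_bounds f A B" and max: "\<And>A'. frame_bounds f A' B \<Longrightarrow> A' \<le> A"
    and X: "coisometry X"
  shows "1 - sqrt A \<le> onorm (\<lambda>h. synthesis f (cadjoint X h) - h)"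
proof (rule ccontr)
  define K where "K = onorm (\<lambda>h. synthesis f (cadjoint X h) - h)"
  note bessel = frame_bounds_bessel[OF AB]
  assume "\<not> ?thesis"
  then have K: "sqrt A < 1 - K" by (simp add: K_def)
  have "0 < A" using AB by (simp add: frame_bounds_def)
  then have "0 < 1 - K" using K by (smt (verit) real_sqrt_gt_zero)
  have "A < (1 - K)\<^sup>2" using K \<open>0 < 1 - K\<close> \<open>0 < A\<close>
    by (smt (verit) real_sqrt_pow2 real_sqrt_gt_zero power_strict_mono zero_less_numeral)
  \<comment> \<open>The infimum of |analysis f h|^2 / |h|^2 need not be attained, so the test vector
    comes from the failure of the strictly larger bound (1 - K)^2. Splitting |h|^2 into <h - y, h> +
    <y, h> with y = \<open>?y\<close> then gives the contradiction.\<close>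
  then have "\<not> frame_bounds f ((1 - K)\<^sup>2) B" using max by force
  then obtain h where "(norm (analysis f h))\<^sup>2 < (1 - K)\<^sup>2 * (norm h)\<^sup>2"
    using AB \<open>0 < 1 - K\<close> unfolding frame_bounds_def norm_analysis[OF bessel]
    by (auto simp: not_le)
  then have "(norm (analysis f h))\<^sup>2 < ((1 - K) * norm h)\<^sup>2"
    by (simp add: power_mult_distrib)
  then have h: "norm (analysis f h) < (1 - K) * norm h"
    using \<open>0 < 1 - K\<close> by (intro power2_less_imp_less[of _ "(1 - K) * norm h"]) auto
  then have "0 < norm h"
    using \<open>0 < 1 - K\<close> by (metis norm_ge_zero mult_zero_right order_le_less not_less)
  let ?y = "synthesis f (cadjoint X h)"
  have "inner ?y h = Re (cinner (cadjoint X h) (analysis f h))"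
    by (metis Re_cinner adjoint_pairD[OF adjoint_pair_synthesis[OF bessel]])
  also have "\<dots> \<le> norm (cadjoint X h) * norm (analysis f h)"
    unfolding Re_cinner by (rule norm_cauchy_schwarz)
  finally have 1: "inner ?y h \<le> norm h * norm (analysis f h)"
    by (simp add: norm_cadjoint_coisometry[OF X])
  have "inner (h - ?y) h \<le> norm (?y - h) * norm h"
    using norm_cauchy_schwarz[of "h - ?y" h] by (simp add: norm_minus_commute)
  also have "\<dots> \<le> K * norm h * norm h"
    unfolding K_def
    by (intro mult_right_mono onorm[OF bounded_linear_synthesis_defect[OF bessel X]]) simp
  finally have "norm h * norm h \<le> K * norm h * norm h + norm h * norm (analysis f h)"
    using 1 by (simp add: inner_diff_left power2_norm_eq_inner[symmetric] power2_eq_square)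
  then have "norm h * ((1 - K) * norm h) \<le> norm h * norm (analysis f h)"
    by (simp add: algebra_simps)
  then show False using h \<open>0 < norm h\<close> by simp
qed

section \<open>The inverse frame operator and a coisometry attaining the bound\<close>

lemma frame_operator_inverse:
  fixes f :: "nat \<Rightarrow> 'h::chilbert_space"
  assumes AB: "frame_bounds f A B"
  obtains R where "adjoint_pair R R"
    "\<And>x. synthesis f (analysis f (R x)) = x" "\<And>x. R (synthesis f (analysis f x)) = x"
    "\<And>x. 0 \<le> inner (R x) x" "\<And>x. A * inner (R x) x \<le> (norm x)\<^sup>2"
proof -
  note bessel = frame_bounds_bessel[OF AB]
  note adj = adjoint_pair_synthesis[OF bessel]
  have "0 < A" using AB by (simp add: frame_bounds_def)
  define S where "S x = synthesis f (analysis f x)" for x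
  have S_adj: "adjoint_pair S S"
    using adjoint_pair_compose[OF adj adjoint_pair_sym[OF adj]] by (simp add: S_def[abs_def])
  have inner_S: "inner (S x) x = (norm (analysis f x))\<^sup>2" for x
    using arg_cong[OF adjoint_pairD[OF adj, of "analysis f x" x], of Re]
    by (simp add: S_def Re_cinner power2_norm_eq_inner)
  have S_ge: "A * (norm x)\<^sup>2 \<le> inner (S x) x" for x
    unfolding inner_S by (rule frame_bounds_le_norm_analysis[OF AB])
  have analysis: "bounded_clinear (analysis f)"
    using adjoint_pair_sym[OF adj] norm_analysis_le[OF bessel]
    by (intro bounded_clinearI) (auto intro: adjoint_pair_additive adjoint_pair_scaleC)
  have S: "bounded_clinear S"
    unfolding S_def[abs_def]
    by (rule bounded_clinear_compose[OF bounded_clinear_synthesis[OF bessel] analysis])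
  then obtain M where M: "0 < M" "\<And>x. norm (S x) \<le> M * norm x"
    using bounded_clinear_bound by blast
  \<comment> \<open>Since <S x, x> is at least A |x|^2 and |S x| is at most M |x|, the square of |x
    - t S x| is at most (1 - 2 t A + t^2 M^2) |x|^2. This \<open>t\<close> minimizes the factor,
    with minimum 1 - A^2 / M^2 < 1.\<close>
  define t where "t = A / M\<^sup>2"
  have "t > 0" using \<open>0 < A\<close> M by (simp add: t_def)
  define r where "r = 1 - 2 * t * A + t\<^sup>2 * M\<^sup>2"
  have "r = 1 - A\<^sup>2 / M\<^sup>2" using M by (simp add: r_def t_def field_simps power2_eq_square)
  then have "r < 1" using \<open>0 < A\<close> M by simp
  have near: "norm (x - t *\<^sub>R S x) \<le> sqrt r * norm x" for x
  proof -
    have "(norm (x - t *\<^sub>R S x))\<^sup>2 = (norm x)\<^sup>2 - 2 * t * inner (S x) x + t\<^sup>2 * (norm (S x))\<^sup>2"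
      unfolding power2_norm_eq_inner
      by (simp add: inner_diff_left inner_diff_right inner_commute power2_eq_square algebra_simps)
    also have "\<dots> \<le> (norm x)\<^sup>2 - 2 * t * (A * (norm x)\<^sup>2) + t\<^sup>2 * (M * norm x)\<^sup>2"
      using S_ge[of x] M(2)[of x] \<open>t > 0\<close>
      by (intro add_mono diff_mono mult_left_mono power_mono) auto
    also have "\<dots> = r * (norm x)\<^sup>2" by (simp add: r_def algebra_simps)
    finally have "norm (x - t *\<^sub>R S x) \<le> sqrt (r * (norm x)\<^sup>2)"
      by (rule real_le_rsqrt)
    then show ?thesis by (simp add: real_sqrt_mult)
  qed
  obtain R where R: "bounded_clinear R" "\<And>x. S (R x) = x" "\<And>x. R (S x) = x"
    using near_identity_invertible[OF S \<open>t > 0\<close> _ near] \<open>r < 1\<close> by auto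
  have "adjoint_pair R R"
    unfolding adjoint_pair_def by (metis R(2) adjoint_pairD[OF S_adj])
  moreover have pos: "0 \<le> inner (R x) x" for x
    using inner_S[of "R x"] by (simp add: R inner_commute)
  moreover have "A * inner (R x) x \<le> (norm x)\<^sup>2" for x
  proof -
    \<comment> \<open>The lower bound of \<open>S\<close> at R x turns into a norm bound for
      \<open>R\<close>, hence into the upper bound for its quadratic form.\<close>
    have "A * (norm (R x))\<^sup>2 \<le> inner x (R x)" using S_ge[of "R x"] by (simp add: R)
    also have "\<dots> \<le> norm x * norm (R x)" by (rule norm_cauchy_schwarz)
    finally have "A * norm (R x) \<le> norm x"
      by (cases "R x = 0") (auto simp: power2_eq_square simp flip: mult.assoc)
    have "A * inner (R x) x \<le> A * (norm (R x) * norm x)"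
      using \<open>0 < A\<close> by (intro mult_left_mono norm_cauchy_schwarz) simp
    also have "\<dots> \<le> (norm x)\<^sup>2"
      using mult_right_mono[OF \<open>A * norm (R x) \<le> norm x\<close>, of "norm x"]
      by (simp add: power2_eq_square mult_ac)
    finally show ?thesis .
  qed
  ultimately show ?thesis using that R by (simp add: S_def)
qed

lemma subspace_nullspace:
  assumes "bounded_clinear T"
  shows "complex_vector.subspace (nullspace T)"
  using assms
  by (simp add: complex_vector.subspace_def nullspace_def bounded_clinear_add
      bounded_clinear_scaleC bounded_clinear_zero)

text \<open>The correction into the nullspace is \<open>synthesis u\<close> after
  \<open>analysis g\<close>. The sequence \<open>g\<close> factors the missing part \<open>P\<close>
  through \<open>ell2\<close>, and the orthonormal sequence \<open>u\<close> carries
  \<open>ell2\<close> isometrically into the nullspace without changing that factorization.\<close>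

lemma scalar_coisometry:
  fixes f :: "nat \<Rightarrow> 'h::chilbert_space"
  assumes separable: "\<exists>D :: 'h set. countable D \<and> closure D = UNIV"
    and AB: "frame_bounds f A B"
    and null: "infinite_cdim (nullspace (synthesis f))"
    and c: "c\<^sup>2 \<le> A"
  obtains X where "coisometry X" "\<And>h. synthesis f (cadjoint X h) = c *\<^sub>R h"
proof -
  note bessel_f = frame_bounds_bessel[OF AB]
  note adj_f = adjoint_pair_synthesis[OF bessel_f]
  note F = bounded_clinear_synthesis[OF bessel_f]
  obtain R where R: "adjoint_pair R R"
    "\<And>x. synthesis f (analysis f (R x)) = x" "\<And>x. R (synthesis f (analysis f x)) = x"
    "\<And>x. 0 \<le> inner (R x) x" "\<And>x. A * inner (R x) x \<le> (norm x)\<^sup>2"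
    using frame_operator_inverse[OF AB] by blast
  \<comment> \<open>\<open>P\<close> is what the scaled canonical dual part leaves missing from an
    isometry. It is positive because c^2 R lies below A R, which lies below the identity.\<close>
  define P where "P x = x - c\<^sup>2 *\<^sub>R R x" for x
  have "positive_contraction P"
    unfolding positive_contraction_def
  proof (intro conjI allI)
    show "adjoint_pair P P"
      using R(1) by (simp add: adjoint_pair_def P_def cinner_diff_left cinner_diff_right
          cinner_scaleR_left cinner_scaleR_right)
    fix x
    have "inner (P x) x = (norm x)\<^sup>2 - c\<^sup>2 * inner (R x) x"
      by (simp add: P_def inner_diff_left power2_norm_eq_inner)
    moreover have "c\<^sup>2 * inner (R x) x \<le> A * inner (R x) x"
      using c R(4) by (rule mult_right_mono)
    ultimately show "0 \<le> inner (P x) x" "inner (P x) x \<le> (norm x)\<^sup>2"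
      using R(4)[of x] R(5)[of x] by simp_all
  qed
  then obtain g where bessel_g: "bessel g 1" and g: "\<And>h. synthesis g (analysis g h) = P h"
    using positive_contraction_factorization[OF separable] by blast
  obtain u where u: "orthonormal u" and Fu: "\<And>n. synthesis f (u n) = 0"
    using infinite_cdim_orthonormal[OF subspace_nullspace[OF F] null]
    by (auto simp: nullspace_def)
  note bessel_u = bessel_orthonormal[OF u]
  note adj_u = adjoint_pair_synthesis[OF bessel_u]
  note adj_g = adjoint_pair_synthesis[OF bessel_g]
  \<comment> \<open>The vectors \<open>u n\<close> lie in the nullspace of the synthesis operator,
    hence are orthogonal to the range of \<open>analysis f\<close>. This removes the cross terms
    below.\<close>
  have uf: "analysis u (analysis f h) = 0" for h
    by (rule ell2_eqI)
       (simp add: ell2_coord_analysis[OF bessel_u] zero_ell2.rep_eq Fu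
          adjoint_pairD[OF adjoint_pair_sym[OF adj_f]])
  have fu: "synthesis f (synthesis u a) = 0" for a
    by (rule cinner_ext) (simp add: adjoint_pairD[OF adj_f] adjoint_pairD[OF adj_u] uf)
  define V where "V h = c *\<^sub>R analysis f (R h) + synthesis u (analysis g h)" for h
  \<comment> \<open>\<open>X\<close> is written down as the termwise adjoint of \<open>V\<close>, so
    uniqueness gives \<open>cadjoint X = V\<close>, and \<open>X (V h)\<close> becomes c^2 R h + P h
    = h.\<close>
  define X where "X a = c *\<^sub>R R (synthesis f a) + synthesis g (analysis u a)" for a
  have adj: "adjoint_pair X V"
    by (simp add: adjoint_pair_def X_def V_def cinner_add_left cinner_add_right cinner_scaleR_left
        cinner_scaleR_right adjoint_pairD[OF R(1)] adjoint_pairD[OF adj_f] adjoint_pairD[OF adj_g]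
        adjoint_pairD[OF adjoint_pair_sym[OF adj_u]])
  have FV: "synthesis f (V h) = c *\<^sub>R h" for h
    by (simp add: V_def bounded_clinear_add[OF F] bounded_clinear_scaleR[OF F] fu R(2))
  have uV: "analysis u (V h) = analysis g h" for h
    by (simp add: V_def adjoint_pair_additive[OF adjoint_pair_sym[OF adj_u]]
        adjoint_pair_scaleR[OF adjoint_pair_sym[OF adj_u]] uf analysis_synthesis_orthonormal[OF u])
  have XV: "X (V h) = h" for h
    by (simp add: X_def FV uV g P_def adjoint_pair_scaleR[OF R(1)] power2_eq_square)
  have "norm (V h) \<le> 1 * norm h" for h
  proof -
    have "inner (V h) (V h) = inner h h"
      by (metis adj adjoint_pairD Re_cinner XV)
    then show ?thesis by (simp add: norm_eq_sqrt_inner)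
  qed
  then have "bounded_clinear X"
    by (rule adjoint_pair_bounded_clinear[OF adj zero_le_one])
  moreover have "cadjoint X = V" using adj by (rule cadjoint_eqI)
  ultimately have "coisometry X" by (simp add: coisometry_def XV fun_eq_iff)
  then show ?thesis using that FV \<open>cadjoint X = V\<close> by simp
qed

theorem theorem13:
  fixes f :: "nat \<Rightarrow> 'h::chilbert_space"
  assumes separable: "\<exists>D :: 'h set. countable D \<and> closure D = UNIV"
    and infinite_dimensional: "infinite_cdim (UNIV :: 'h set)"
    and frame: "is_frame f"
    and infinite_nullity: "infinite_cdim (nullspace (synthesis f))"
  shows "frame_alpha f = 1 - min (sqrt (optimal_lower_frame_bound f)) 1
    \<and> frame_minimizers f \<noteq> {}
    \<and> (\<forall>X \<in> frame_minimizers f. invertible_operator (synthesis f \<circ> cadjoint X))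
    \<and> (\<exists>X \<in> frame_minimizers f. \<forall>h. (synthesis f \<circ> cadjoint X) h
           = complex_of_real (min (sqrt (optimal_lower_frame_bound f)) 1) *\<^sub>C h)"
proof -
  \<comment> \<open>A nonzero vector is what guarantees that the optimal lower bound exists.\<close>
  have "\<exists>h :: 'h. h \<noteq> 0"
  proof (rule ccontr)
    assume "\<not> ?thesis"
    then have "complex_vector.span {} = (UNIV :: 'h set)" by auto
    then show False using infinite_dimensional unfolding infinite_cdim_def by blast
  qed
  then obtain B where AB: "frame_bounds f (optimal_lower_frame_bound f) B"
    and max: "\<And>A' B'. frame_bounds f A' B' \<Longrightarrow> A' \<le> optimal_lower_frame_bound f"
    using optimal_lower_frame_bound[OF frame] by metis
  define A where "A = optimal_lower_frame_bound f"
  define c where "c = min (sqrt A) 1"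
  note bessel = frame_bounds_bessel[OF AB]
  have "0 < A" using AB by (simp add: A_def frame_bounds_def)
  then have "0 < c" "c \<le> 1" by (simp_all add: c_def)
  have "c\<^sup>2 \<le> (sqrt A)\<^sup>2" using \<open>0 < c\<close> by (intro power_mono) (simp_all add: c_def)
  then have "c\<^sup>2 \<le> A" using \<open>0 < A\<close> by simp
  define \<delta> where "\<delta> X = onorm (\<lambda>h. synthesis f (cadjoint X h) - h)" for X
  \<comment> \<open>If \<open>sqrt A\<close> is at most 1 this is the defect estimate; otherwise
    \<open>c = 1\<close> and it is nonnegativity of the operator norm.\<close>
  have lower: "1 - c \<le> \<delta> X" if X: "coisometry X" for X
    using onorm_synthesis_defect_ge[OF AB max X]
      onorm_pos_le[OF bounded_linear_synthesis_defect[OF bessel X]]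
    by (auto simp: \<delta>_def c_def A_def min_def)
  obtain X where X: "coisometry X" "\<And>h. synthesis f (cadjoint X h) = c *\<^sub>R h"
    using scalar_coisometry[OF separable AB infinite_nullity] \<open>c\<^sup>2 \<le> A\<close> unfolding A_def by blast
  have "\<delta> X \<le> 1 - c"
    unfolding \<delta>_def
  proof (rule onorm_bound)
    show "norm (synthesis f (cadjoint X h) - h) \<le> (1 - c) * norm h" for h
    proof -
      have "norm (c *\<^sub>R h - h) = norm ((c - 1) *\<^sub>R h)" by (simp add: algebra_simps)
      then show ?thesis using \<open>c \<le> 1\<close> by (simp add: X)
    qed
  qed (use \<open>c \<le> 1\<close> in simp)
  then have \<delta>X: "\<delta> X = 1 - c" using lower[OF X(1)] by simp
  have alpha: "frame_alpha f = 1 - c"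
    unfolding frame_alpha_def \<delta>_def[symmetric]
    by (rule cInf_eq_minimum) (use X(1) \<delta>X[symmetric] lower in auto)
  have X_min: "X \<in> frame_minimizers f"
    using X(1) \<delta>X alpha by (simp add: frame_minimizers_def \<delta>_def)
  have inv: "invertible_operator (synthesis f \<circ> cadjoint Y)" if "Y \<in> frame_minimizers f" for Y
  proof -
    have Y: "coisometry Y" "\<delta> Y = 1 - c"
      using that alpha by (auto simp: frame_minimizers_def \<delta>_def)
    let ?T = "\<lambda>h. synthesis f (cadjoint Y h)"
    have T: "bounded_clinear ?T"
      by (rule bounded_clinear_compose[OF bounded_clinear_synthesis[OF bessel]
            bounded_clinear_cadjoint_coisometry[OF Y(1)]])
    \<comment> \<open>Every minimizer has defect exactly 1 - c, and \<open>0 < c\<close> makes this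
      a contraction constant, so the inversion lemma applies with scale 1.\<close>
    have "norm (h - 1 *\<^sub>R ?T h) \<le> (1 - c) * norm h" for h
      using onorm[OF bounded_linear_synthesis_defect[OF bessel Y(1)], of h] Y(2)
      by (simp add: \<delta>_def norm_minus_commute)
    then obtain R where "bounded_clinear R" "\<And>x. ?T (R x) = x" "\<And>x. R (?T x) = x"
      using near_identity_invertible[OF T, of 1 "1 - c"] \<open>0 < c\<close> by auto
    then show ?thesis
      using T by (auto simp: invertible_operator_def o_def id_def)
  qed
  show ?thesis
    unfolding A_def[symmetric] c_def[symmetric]
    using alpha X_min inv X(2) by (auto simp: scaleC_of_real)
qed

end
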